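(* Let $n,q\ge 1$, let $B_k\in\mathbb{R}^{n\times n}$ be symmetric positive definite, and let $S_k,Y_k\in\mathbb{R}^{n\times q}$ be such that $S_k^TY_k$ is symmetric positive definite. Then a solution $B^*$ of $$\min_{\{B=B^T,\;B>0\}}\ \mathbb{D}\left(B^{-1}\,\|\,B_k^{-1}\right)\quad\text{subject to}\quad B^{-1}Y_k=S_k$$ is given by $B^*=B_{k+1}$, where $$B_{k+1}^{-1}=\left(I_n-Y_k(S_k^TY_k)^{-1}S_k^T\right)^TB_k^{-1}\left(I_n-Y_k(S_k^TY_k)^{-1}S_k^T\right)+S_k(S_k^TY_k)^{-1}S_k^T.$$
   Context: For symmetric positive definite $n\times n$ real matrices $P,Q$, the relative entropy between the zero-mean Gaussian distributions with covariances $P$ and $Q$ is written in terms of the inverse matrices as $$\mathbb{D}(P^{-1}\|Q^{-1})=\frac12\left[\log\det(P^{-1}Q)+\operatorname{trace}(Q^{-1}P)-n\right].$$ Here $B>0$ means that $B$ is positive definite; the minimization is over all symmetric positive definite $n\times n$ real matrices $B$ satisfying the constraint. *)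

theory Defs
  imports "HOL-Analysis.Analysis"
begin

definition sym_posdef :: "real^'n^'n \<Rightarrow> bool" where
  "sym_posdef A \<longleftrightarrow> transpose A = A \<and> (\<forall>x. x \<noteq> 0 \<longrightarrow> x \<bullet> (A *v x) > 0)"

(* Relative entropy of N(0,P) with respect to N(0,Q).  The arguments are the covariance
   matrices P and Q; in the notation by inverse matrices this is D(P^{-1} || Q^{-1}).
   It is meant for symmetric positive definite P and Q only. *)
definition gaussian_rel_entropy :: "real^'n^'n \<Rightarrow> real^'n^'n \<Rightarrow> real" where
  "gaussian_rel_entropy P Q =
     (1/2) * (ln (det (matrix_inv P ** Q)) + trace (matrix_inv Q ** P) - real CARD('n))"

(* The block BFGS update of the inverse matrix, i.e. B_{k+1}^{-1} in terms of B_k, S_k, Y_k. *)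
definition block_bfgs_inv :: "real^'n^'n \<Rightarrow> real^'q^'n \<Rightarrow> real^'q^'n \<Rightarrow> real^'n^'n" where
  "block_bfgs_inv B S Y =
     transpose (mat 1 - Y ** matrix_inv (transpose S ** Y) ** transpose S)
       ** matrix_inv B
       ** (mat 1 - Y ** matrix_inv (transpose S ** Y) ** transpose S)
     + S ** matrix_inv (transpose S ** Y) ** transpose S"

end

theory Submission
  imports Defs
begin

text \<open>
  On feasible matrices the constraint reads \<open>B S = Y\<close>, which is linear in \<open>B\<close>. Let \<open>H\<close> be the
  updated inverse and \<open>B\<^sub>1\<close> its inverse. For feasible \<open>B\<close> the symmetric matrix \<open>B - B\<^sub>1\<close> annihilates
  \<open>S\<close>, and \<open>H\<close> differs from the inverse of \<open>B\<^sub>k\<close> only by terms with a left factor \<open>S\<close> or a right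
  factor \<open>S\<^sup>T\<close>; hence both have the same trace against \<open>B - B\<^sub>1\<close>. The entropy difference between
  \<open>B\<close> and \<open>B\<^sub>1\<close> therefore equals \<open>(trace (H B) - n - log det (H B)) / 2\<close>, the entropy of \<open>B\<close>
  relative to \<open>B\<^sub>1\<close>. It is nonnegative: \<open>H B\<close> has the determinant and trace of a positive definite
  matrix, and \<open>ln x \<le> x - 1\<close> holds for each eigenvalue.
\<close>

section \<open>Spectral theorem for real symmetric matrices\<close>

lemma symmetric_matrix_inner:
  fixes A :: "real^'n^'n"
  assumes "transpose A = A"
  shows "(A *v x) \<bullet> y = x \<bullet> (A *v y)"
  by (metis assms dot_lmul_matrix transpose_matrix_vector)

text \<open>Induction on \<open>J\<close>: symmetry makes the orthogonal complement \<open>W\<close>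
  of the eigenvectors found so far invariant under \<open>A\<close>, and a maximiser of the Rayleigh
  quotient on the unit sphere of \<open>W\<close> is one more eigenvector. Indexing the vectors by
  subsets of the coordinate type lets \<open>J = UNIV\<close> yield a full orthonormal
  basis.\<close>

lemma symmetric_matrix_orthonormal_eigenvectors:
  fixes A :: "real^'n^'n" and J :: "'n set"
  assumes sym: "transpose A = A"
  shows "\<exists>v d. \<forall>i\<in>J. A *v v i = d i *\<^sub>R v i \<and> (\<forall>j\<in>J. v i \<bullet> v j = (if i = j then 1 else 0))"
proof -
  have "finite J" by simp
  then show ?thesis
  proof (induction J)
    case empty
    then show ?case by simp
  next
    case (insert k J)
    then obtain v d where eig: "\<And>i. i \<in> J \<Longrightarrow> A *v v i = d i *\<^sub>R v i"
      and orth: "\<And>i j. i \<in> J \<Longrightarrow> j \<in> J \<Longrightarrow> v i \<bullet> v j = (if i = j then 1 else 0)"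
      by blast
    define W where "W = {x. \<forall>i\<in>J. v i \<bullet> x = 0}"
    \<comment> \<open>Since \<open>k\<close> lies outside \<open>J\<close>, the vectors found so far
      span a proper subspace. Hence \<open>W\<close> contains a nonzero vector, and its unit sphere
      is nonempty.\<close>
    have "dim (v ` J) \<le> card J"
      using insert.hyps(1) by (meson card_image_le dim_le_card' finite_imageI le_trans)
    also have "card J < CARD('n)"
      using insert.hyps by (metis UNIV_I finite psubsetI psubset_card_mono subset_UNIV)
    finally have "dim (v ` J) < DIM(real^'n)" by simp
    then obtain x0 where x0: "x0 \<noteq> 0" "\<And>y. y \<in> span (v ` J) \<Longrightarrow> orthogonal x0 y"
      using orthogonal_to_subspace_exists by blast
    have x0W: "x0 \<in> W"
      unfolding W_def
    proof (intro CollectI ballI)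
      fix i assume "i \<in> J"
      then have "orthogonal x0 (v i)" by (intro x0(2) span_base imageI)
      then show "v i \<bullet> x0 = 0" by (simp add: orthogonal_def inner_commute)
    qed
    have W_add: "x + c *\<^sub>R y \<in> W" if "x \<in> W" "y \<in> W" for x y c
      using that by (simp add: W_def inner_add_right)
    have W_scale: "c *\<^sub>R y \<in> W" if "y \<in> W" for y c
      using that by (simp add: W_def)
    have W_A: "A *v y \<in> W" if "y \<in> W" for y
      using that by (auto simp: W_def symmetric_matrix_inner[OF sym, symmetric] eig)
    have "closed W"
      unfolding W_def Collect_ball_eq
      by (intro closed_INT ballI closed_Collect_eq continuous_intros)
    then have cpt: "compact (sphere 0 1 \<inter> W)"
      by (intro compact_Int_closed compact_sphere)
    have "(1 / norm x0) *\<^sub>R x0 \<in> sphere 0 1 \<inter> W"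
      using x0 x0W W_scale by simp
    then have ne: "sphere 0 1 \<inter> W \<noteq> {}" by blast
    have cont: "continuous_on (sphere 0 1 \<inter> W) (\<lambda>x. x \<bullet> (A *v x))"
      by (intro continuous_intros linear_continuous_on_compose[OF _ matrix_vector_mul_linear])
    obtain w where w: "w \<in> sphere 0 1 \<inter> W"
      and max: "\<And>y. y \<in> sphere 0 1 \<inter> W \<Longrightarrow> y \<bullet> (A *v y) \<le> w \<bullet> (A *v w)"
      using continuous_attains_sup[OF cpt ne cont] by blast
    define l where "l = w \<bullet> (A *v w)"
    have ww: "w \<bullet> w = 1" and wW: "w \<in> W"
      using w by (auto simp: norm_eq_1)
    have rayleigh: "y \<bullet> (A *v y) \<le> l * (y \<bullet> y)" if "y \<in> W" for y
    proof (cases "y = 0")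
      case False
      have "(1 / norm y) *\<^sub>R y \<in> sphere 0 1 \<inter> W"
        using False that W_scale by simp
      from max[OF this] have "y \<bullet> (A *v y) / (norm y * norm y) \<le> l"
        by (simp add: l_def matrix_vector_mult_scaleR)
      then show ?thesis
        using False by (simp add: divide_simps dot_square_norm power2_eq_square)
    qed simp
    define r where "r = A *v w - l *\<^sub>R w"
    have rW: "r \<in> W"
      unfolding r_def using W_add[OF W_A[OF wW] wW, of "- l"] by simp
    \<comment> \<open>the maximiser is a critical point: moving from it in the direction of the residual
      would otherwise increase the quotient\<close>
    have ineq: "2 * t * (r \<bullet> r) \<le> t\<^sup>2 * (l * (r \<bullet> r) - r \<bullet> (A *v r))" for t
    proof -
      have Aw: "A *v w = r + l *\<^sub>R w" by (simp add: r_def)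
      have "w \<bullet> (A *v r) = r \<bullet> r + l * (w \<bullet> r)"
        by (simp add: symmetric_matrix_inner[OF sym, symmetric] Aw inner_add_left)
      moreover have wr: "w \<bullet> r = 0"
        by (simp add: r_def inner_diff_right ww l_def[symmetric])
      moreover have "r \<bullet> (A *v w) = r \<bullet> r"
        using wr by (simp add: Aw inner_add_right inner_commute)
      ultimately have "(w + t *\<^sub>R r) \<bullet> (A *v (w + t *\<^sub>R r)) = l + 2 * t * (r \<bullet> r) + t\<^sup>2 * (r \<bullet> (A *v r))"
        by (simp add: l_def[symmetric] power2_eq_square algebra_simps)
      moreover have "(w + t *\<^sub>R r) \<bullet> (w + t *\<^sub>R r) = 1 + t\<^sup>2 * (r \<bullet> r)"
        using wr ww by (simp add: inner_add_left inner_add_right inner_commute power2_eq_square)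
      ultimately show ?thesis
        using rayleigh[OF W_add[OF wW rW, of t]] by (simp add: algebra_simps)
    qed
    have "r \<bullet> r = 0"
    proof (rule ccontr)
      assume "r \<bullet> r \<noteq> 0"
      then have pos: "r \<bullet> r > 0" by (simp add: less_le)
      \<comment> \<open>The left side of \<open>ineq\<close> is linear in \<open>t\<close> and the
        right side quadratic, so a small positive \<open>t\<close> must fail if \<open>r\<close> is
        nonzero. Here \<open>q\<close> bounds the quadratic coefficient, and the \<open>+ 1\<close>
        keeps it positive, so one may take \<open>t = (r \<bullet> r) / q\<close>.\<close>
      define q where "q = \<bar>l * (r \<bullet> r) - r \<bullet> (A *v r)\<bar> + 1"
      have q: "q > 0" "l * (r \<bullet> r) - r \<bullet> (A *v r) \<le> q" by (auto simp: q_def)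
      let ?t = "(r \<bullet> r) / q"
      have "2 * ?t * (r \<bullet> r) \<le> ?t\<^sup>2 * q"
        using ineq[of ?t] mult_left_mono[OF q(2), of "?t\<^sup>2"] by simp
      then have "2 * (r \<bullet> r)\<^sup>2 \<le> (r \<bullet> r)\<^sup>2"
        using q(1) by (simp add: field_simps power2_eq_square)
      then show False using pos by simp
    qed
    then have Aw: "A *v w = l *\<^sub>R w" by (simp add: r_def)
    have "\<forall>i\<in>insert k J. A *v (v(k := w)) i = (d(k := l)) i *\<^sub>R (v(k := w)) i \<and>
        (\<forall>j\<in>insert k J. (v(k := w)) i \<bullet> (v(k := w)) j = (if i = j then 1 else 0))"
      using insert.hyps(2) eig orth wW ww Aw by (auto simp: W_def inner_commute)
    then show ?case by blast
  qed
qed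

theorem symmetric_matrix_spectral:
  fixes A :: "real^'n^'n"
  assumes sym: "transpose A = A"
  obtains U :: "real^'n^'n" and d :: "'n \<Rightarrow> real"
  where "orthogonal_matrix U" "transpose U ** A ** U = (\<chi> i j. if i = j then d i else 0)"
proof -
  obtain v :: "'n \<Rightarrow> real^'n" and d where eig: "\<And>i. A *v v i = d i *\<^sub>R v i"
    and orth: "\<And>i j. v i \<bullet> v j = (if i = j then 1 else 0)"
    using symmetric_matrix_orthonormal_eigenvectors[OF sym, of UNIV] by blast
  define U :: "real^'n^'n" where "U = (\<chi> i j. v j $ i)"
  have col: "column j U = v j" for j
    by (simp add: U_def column_def vec_eq_iff)
  have "(transpose U ** A ** U) $ i $ j = v i \<bullet> (A *v v j)" for i j
  proof -
    have "(transpose U ** (A ** U)) $ i $ j = (\<Sum>k\<in>UNIV. v i $ k * (A ** U) $ k $ j)"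
      by (simp add: matrix_matrix_mult_def transpose_def U_def)
    also have "\<dots> = (\<Sum>k\<in>UNIV. v i $ k * (A *v v j) $ k)"
      by (simp add: matrix_matrix_mult_def matrix_vector_mult_def U_def)
    finally show ?thesis by (simp add: inner_vec_def matrix_mul_assoc)
  qed
  then have "transpose U ** A ** U = (\<chi> i j. if i = j then d i else 0)"
    by (simp add: vec_eq_iff eig orth)
  moreover have "orthogonal_matrix U"
    by (simp add: orthogonal_matrix_orthonormal_columns col orthogonal_def orth norm_eq_1)
  ultimately show thesis using that by blast
qed

section \<open>Positive definite matrices: congruence, inverse and factorization\<close>

lemma inner_matrix_congruence:
  fixes A :: "real^'n^'n" and L :: "real^'m^'n"
  shows "x \<bullet> ((transpose L ** A ** L) *v x) = (L *v x) \<bullet> (A *v (L *v x))"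
  by (metis dot_lmul_matrix matrix_vector_mul_assoc transpose_matrix_vector transpose_transpose)

lemma sym_posdef_congruence:
  fixes A :: "real^'n^'n" and L :: "real^'m^'n"
  assumes "sym_posdef A" and "\<And>x. L *v x = 0 \<Longrightarrow> x = 0"
  shows "sym_posdef (transpose L ** A ** L)"
  using assms unfolding sym_posdef_def inner_matrix_congruence
  by (metis matrix_mul_assoc matrix_transpose_mul transpose_transpose)

lemma sym_posdef_imp_invertible:
  assumes "sym_posdef A"
  shows "invertible A"
proof -
  have "A *v x = 0 \<Longrightarrow> x = 0" for x
    using assms unfolding sym_posdef_def by (metis inner_zero_right less_irrefl)
  then show ?thesis
    by (metis invertible_left_inverse matrix_left_invertible_ker)
qed

text \<open>\<open>matrix_inv\<close> is a choice among two-sided inverses. For square matrices a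
  right inverse is also a left inverse, so the choice is forced.\<close>

lemma matrix_inv_unique_right:
  fixes A :: "real^'n^'n"
  assumes "A ** B = mat 1"
  shows "matrix_inv A = B"
proof -
  have BA: "B ** A = mat 1" using assms by (simp add: matrix_left_right_inverse)
  have "\<exists>A'. A ** A' = mat 1 \<and> A' ** A = mat 1" using assms BA by blast
  then have "matrix_inv A ** A = mat 1"
    unfolding matrix_inv_def by (rule someI2_ex) simp
  then show ?thesis
    by (metis assms matrix_mul_assoc matrix_mul_lid matrix_mul_rid)
qed

lemma invertible_matrix_inv_mul:
  fixes A :: "real^'n^'n"
  assumes "invertible A"
  shows "A ** matrix_inv A = mat 1" "matrix_inv A ** A = mat 1"
  using assms matrix_inv_unique_right unfolding invertible_def by metis+

text \<open>The inverse is symmetric, hence equal to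
  \<open>transpose (matrix_inv A) ** A ** matrix_inv A\<close>, a congruence of \<open>A\<close> by
  an injective matrix.\<close>

lemma sym_posdef_matrix_inv:
  assumes "sym_posdef A"
  shows "sym_posdef (matrix_inv A)"
proof -
  note inv = invertible_matrix_inv_mul[OF sym_posdef_imp_invertible[OF assms]]
  have symA: "transpose A = A" using assms by (simp add: sym_posdef_def)
  have "transpose (matrix_inv A) = matrix_inv A"
    by (metis inv(2) matrix_inv_unique_right matrix_transpose_mul symA transpose_mat)
  then have "transpose (matrix_inv A) ** A ** matrix_inv A = matrix_inv A"
    by (simp add: inv)
  moreover have "matrix_inv A *v x = 0 \<Longrightarrow> x = 0" for x
    by (metis inv(1) matrix_vector_mul_assoc matrix_vector_mul_lid matrix_vector_mult_0_right)
  ultimately show ?thesis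
    using sym_posdef_congruence[OF assms, of "matrix_inv A"] by simp
qed

lemma sym_posdef_spectral:
  fixes A :: "real^'n^'n"
  assumes "sym_posdef A"
  obtains U :: "real^'n^'n" and d :: "'n \<Rightarrow> real"
  where "orthogonal_matrix U" "transpose U ** A ** U = (\<chi> i j. if i = j then d i else 0)"
    "\<forall>i. d i > 0"
proof -
  obtain U :: "real^'n^'n" and d :: "'n \<Rightarrow> real" where U: "orthogonal_matrix U"
    and D: "transpose U ** A ** U = (\<chi> i j. if i = j then d i else 0)"
    using symmetric_matrix_spectral assms[unfolded sym_posdef_def, THEN conjunct1] .
  have "U *v x = 0 \<Longrightarrow> x = 0" for x
    using U unfolding orthogonal_matrix_def
    by (metis matrix_vector_mul_assoc matrix_vector_mul_lid matrix_vector_mult_0_right)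
  then have "sym_posdef (transpose U ** A ** U)"
    by (rule sym_posdef_congruence[OF assms])
  \<comment> \<open>Testing the diagonal matrix on the coordinate vectors reads off its entries
    \<open>d i\<close>.\<close>
  then have "axis i 1 \<bullet> ((transpose U ** A ** U) *v axis i 1) > 0" for i
    by (simp add: sym_posdef_def axis_eq_0_iff)
  then have "d i > 0" for i
    unfolding D by (simp add: inner_axis' matrix_vector_mult_basis column_def)
  then show thesis using that U D by blast
qed

text \<open>Take \<open>L = U ** R\<close>, where \<open>U\<close> diagonalises \<open>A\<close> and
  \<open>R\<close> carries the square roots of the eigenvalues. The factor serves to replace a
  product of two positive definite matrices by a congruence.\<close>

lemma sym_posdef_factor:
  fixes A :: "real^'n^'n"
  assumes "sym_posdef A"
  obtains L :: "real^'n^'n" where "A = L ** transpose L"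
proof -
  obtain U :: "real^'n^'n" and d :: "'n \<Rightarrow> real" where U: "orthogonal_matrix U"
    and D: "transpose U ** A ** U = (\<chi> i j. if i = j then d i else 0)" and d: "\<forall>i. d i > 0"
    using sym_posdef_spectral[OF assms] .
  define R :: "real^'n^'n" where "R = (\<chi> i j. if i = j then sqrt (d i) else 0)"
  have R: "R ** transpose R = transpose U ** A ** U"
    unfolding D R_def using d
    by (simp add: vec_eq_iff matrix_matrix_mult_def transpose_def less_imp_le if_distrib[of "\<lambda>x. _ * x"] cong: if_cong)
  have "A = (U ** transpose U) ** A ** (U ** transpose U)"
    using U by (simp add: orthogonal_matrix_def)
  also have "\<dots> = U ** (transpose U ** A ** U) ** transpose U"
    by (simp only: matrix_mul_assoc)
  also have "\<dots> = (U ** R) ** transpose (U ** R)"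
    by (simp only: R[symmetric] matrix_transpose_mul matrix_mul_assoc)
  finally show thesis by (rule that)
qed

section \<open>The inequality between log-determinant and trace\<close>

lemma sym_posdef_ln_det_le_trace:
  fixes A :: "real^'n^'n"
  assumes "sym_posdef A"
  shows "det A > 0" "ln (det A) \<le> trace A - real CARD('n)"
proof -
  obtain U :: "real^'n^'n" and d :: "'n \<Rightarrow> real" where U: "orthogonal_matrix U"
    and D: "transpose U ** A ** U = (\<chi> i j. if i = j then d i else 0)" and d: "\<forall>i. d i > 0"
    using sym_posdef_spectral[OF assms] .
  have UU: "U ** transpose U = mat 1" using U by (simp add: orthogonal_matrix_def)
  have "det A = det (transpose U ** A ** U)"
    using arg_cong[OF UU, of det] by (simp add: det_mul)
  also have "\<dots> = (\<Prod>i\<in>UNIV. d i)"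
    unfolding D by (subst det_diagonal) auto
  finally have det: "det A = (\<Prod>i\<in>UNIV. d i)" .
  have "trace A = trace (transpose U ** A ** U)"
    using trace_mul_sym[of "transpose U ** A" U] by (simp add: UU matrix_mul_assoc)
  also have "\<dots> = (\<Sum>i\<in>UNIV. d i)"
    unfolding D by (simp add: trace_def)
  finally have tr: "trace A = (\<Sum>i\<in>UNIV. d i)" .
  show "det A > 0" by (simp add: det d prod_pos)
  have "ln (det A) = (\<Sum>i\<in>UNIV. ln (d i))"
    unfolding det by (intro ln_prod) (simp_all add: d[rule_format] less_imp_neq[OF d[rule_format], symmetric])
  also have "\<dots> \<le> (\<Sum>i\<in>UNIV. d i - 1)"
    by (intro sum_mono ln_le_minus_one d[rule_format])
  finally show "ln (det A) \<le> trace A - real CARD('n)"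
    by (simp add: tr sum_subtractf)
qed

text \<open>The product \<open>A ** B\<close> need not be symmetric. With
  \<open>A = L ** transpose L\<close>, cycling the factor \<open>L\<close> to the right end keeps
  determinant and trace and gives the positive definite matrix
  \<open>transpose L ** B ** L\<close>.\<close>

lemma sym_posdef_mult_ln_det_le_trace:
  fixes A B :: "real^'n^'n"
  assumes "sym_posdef A" "sym_posdef B"
  shows "ln (det (A ** B)) \<le> trace (A ** B) - real CARD('n)"
proof -
  obtain L :: "real^'n^'n" where L: "A = L ** transpose L"
    using sym_posdef_factor[OF assms(1)] .
  have "invertible A" using assms(1) by (rule sym_posdef_imp_invertible)
  then have "invertible L"
    unfolding L by (simp add: invertible_det_nz det_mul)
  then have "L *v x = 0 \<Longrightarrow> x = 0" for x
    by (metis invertible_left_inverse matrix_left_invertible_ker)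
  then have "sym_posdef (transpose L ** B ** L)"
    by (rule sym_posdef_congruence[OF assms(2)])
  moreover have "det (A ** B) = det (transpose L ** B ** L)"
    by (simp add: L det_mul)
  moreover have "trace (A ** B) = trace (transpose L ** B ** L)"
    using trace_mul_sym[of "transpose L ** B" L] by (simp add: L matrix_mul_assoc)
  ultimately show ?thesis
    using sym_posdef_ln_det_le_trace(2) by metis
qed

section \<open>Matrix arithmetic and properties of the block BFGS update\<close>

lemma matrix_diff_ldistrib: "A ** (B - C) = A ** B - A ** (C :: real^'p^'n)"
  using matrix_add_ldistrib[of A "B - C" C] by (simp add: algebra_simps)

lemma matrix_add_rdistrib: "(A + B) ** C = A ** C + B ** (C :: real^'p^'n)"
  by (simp add: vec_eq_iff matrix_matrix_mult_def sum.distrib distrib_right)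

lemma matrix_diff_rdistrib: "(A - B) ** C = A ** C - B ** (C :: real^'p^'n)"
  using matrix_add_rdistrib[of "A - B" B C] by (simp add: algebra_simps)


lemma transpose_add: "transpose (A + B) = transpose A + transpose B"
  by (simp add: transpose_def vec_eq_iff)

lemma transpose_diff: "transpose (A - B) = transpose A - transpose B"
  by (simp add: transpose_def vec_eq_iff)

text \<open>The quadratic form at \<open>x\<close> is a sum of two nonnegative terms that cannot
  both vanish for nonzero \<open>x\<close>. If \<open>transpose S *v x = 0\<close>, then
  \<open>E\<close> fixes \<open>x\<close> and the first term is positive; otherwise the second one
  is.\<close>

lemma sym_posdef_block_bfgs_inv:
  fixes B :: "real^'n^'n" and S Y :: "real^'q^'n"
  assumes B: "sym_posdef B" and M: "sym_posdef (transpose S ** Y)"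
  shows "sym_posdef (block_bfgs_inv B S Y)"
proof -
  define N where "N = matrix_inv (transpose S ** Y)"
  define E where "E = mat 1 - Y ** N ** transpose S"
  have H: "block_bfgs_inv B S Y = transpose E ** matrix_inv B ** E + S ** N ** transpose S"
    by (simp add: block_bfgs_inv_def E_def N_def)
  have B': "sym_posdef (matrix_inv B)" using B by (rule sym_posdef_matrix_inv)
  have N: "sym_posdef N" unfolding N_def using M by (rule sym_posdef_matrix_inv)
  have "transpose (block_bfgs_inv B S Y) = block_bfgs_inv B S Y"
    using B' N unfolding H sym_posdef_def
    by (simp add: transpose_add matrix_transpose_mul matrix_mul_assoc)
  moreover have "x \<bullet> (block_bfgs_inv B S Y *v x) > 0" if "x \<noteq> 0" for x
  proof -
    let ?u = "transpose S *v x"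
    have form: "x \<bullet> (block_bfgs_inv B S Y *v x) =
        (E *v x) \<bullet> (matrix_inv B *v (E *v x)) + ?u \<bullet> (N *v ?u)"
      using inner_matrix_congruence[of x E "matrix_inv B"]
        inner_matrix_congruence[of x "transpose S" N]
      by (simp only: H matrix_vector_mult_add_rdistrib inner_add_right transpose_transpose)
    have nonneg: "y \<bullet> (C *v y) \<ge> 0" if "sym_posdef C" for C :: "real^'m^'m" and y
      using that unfolding sym_posdef_def by (cases "y = 0") (auto simp: less_imp_le)
    show ?thesis
    proof (cases "?u = 0")
      case True
      have "E *v x = x - (Y ** N) *v ?u"
        by (simp only: E_def matrix_vector_mult_diff_rdistrib matrix_vector_mul_lid
            matrix_vector_mul_assoc)
      then have "E *v x = x" by (simp only: True matrix_vector_mult_0_right diff_0_right)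
      then have "(E *v x) \<bullet> (matrix_inv B *v (E *v x)) > 0"
        using B' that unfolding sym_posdef_def by simp
      then show ?thesis unfolding form using nonneg[OF N, of ?u] by linarith
    next
      case False
      then have "?u \<bullet> (N *v ?u) > 0" using N unfolding sym_posdef_def by blast
      then show ?thesis unfolding form using nonneg[OF B', of "E *v x"] by linarith
    qed
  qed
  ultimately show ?thesis unfolding sym_posdef_def by blast
qed

text \<open>The projection \<open>E\<close> kills \<open>Y\<close>, so only the last summand of the
  update acts on \<open>Y\<close>, and there \<open>N\<close> cancels
  \<open>transpose S ** Y\<close>.\<close>

lemma block_bfgs_inv_secant:
  fixes B :: "real^'n^'n" and S Y :: "real^'q^'n"
  assumes "invertible (transpose S ** Y)"
  shows "block_bfgs_inv B S Y ** Y = S"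
proof -
  define N where "N = matrix_inv (transpose S ** Y)"
  define E where "E = mat 1 - Y ** N ** transpose S"
  have N: "N ** (transpose S ** Y) = mat 1"
    unfolding N_def by (rule invertible_matrix_inv_mul(2)[OF assms])
  have "E ** Y = Y - Y ** (N ** (transpose S ** Y))"
    by (simp add: E_def matrix_diff_rdistrib matrix_mul_assoc)
  then have EY: "E ** Y = 0" by (simp add: N)
  have "block_bfgs_inv B S Y ** Y
      = transpose E ** matrix_inv B ** (E ** Y) + S ** (N ** (transpose S ** Y))"
    by (simp add: block_bfgs_inv_def E_def N_def matrix_add_rdistrib matrix_mul_assoc)
  then show ?thesis by (simp add: EY N)
qed

text \<open>\<open>D\<close> stands for the difference of two feasible matrices. The two
  annihilation conditions give \<open>E ** D = D\<close> and \<open>D ** transpose E = D\<close>, so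
  both projections disappear once the trace is cycled, and the last summand of the update
  contributes nothing.\<close>

lemma trace_block_bfgs_inv_mult:
  fixes B D :: "real^'n^'n" and S Y :: "real^'q^'n"
  assumes sym: "transpose (transpose S ** Y) = transpose S ** Y" "invertible (transpose S ** Y)"
    and D: "D ** S = 0" "transpose S ** D = 0"
  shows "trace (block_bfgs_inv B S Y ** D) = trace (matrix_inv B ** D)"
proof -
  define N where "N = matrix_inv (transpose S ** Y)"
  define E where "E = mat 1 - Y ** N ** transpose S"
  have H: "block_bfgs_inv B S Y = transpose E ** matrix_inv B ** E + S ** N ** transpose S"
    by (simp add: block_bfgs_inv_def E_def N_def)
  have ED: "E ** D = D"
    by (simp add: E_def matrix_diff_rdistrib matrix_mul_assoc[symmetric] D)
  have DE: "D ** transpose E = D"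
    by (simp add: E_def transpose_diff matrix_transpose_mul matrix_diff_ldistrib matrix_mul_assoc D)
  have "block_bfgs_inv B S Y ** D = transpose E ** (matrix_inv B ** D)"
    by (simp add: H matrix_add_rdistrib matrix_mul_assoc[symmetric] ED D)
  then have "trace (block_bfgs_inv B S Y ** D) = trace (matrix_inv B ** (D ** transpose E))"
    using trace_mul_sym[of "transpose E" "matrix_inv B ** D"] by (simp add: matrix_mul_assoc)
  then show ?thesis by (simp add: DE)
qed

section \<open>Comparison of entropies and optimality of the update\<close>

lemma ln_det_matrix_inv_mult:
  fixes A B :: "real^'n^'n"
  assumes "sym_posdef A" "sym_posdef B"
  shows "ln (det (matrix_inv A ** B)) = ln (det B) - ln (det A)"
proof -
  have "det (matrix_inv A) * det A = 1"
    by (metis assms(1) det_I det_mul invertible_matrix_inv_mul(2) sym_posdef_imp_invertible)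
  then have "det (matrix_inv A ** B) = det B / det A"
    using sym_posdef_ln_det_le_trace(1)[OF assms(1)] by (simp add: det_mul field_simps)
  then show ?thesis
    using sym_posdef_ln_det_le_trace(1)[OF assms(1)] sym_posdef_ln_det_le_trace(1)[OF assms(2)]
    by (simp add: ln_div)
qed

theorem corollary4p1:
  fixes B\<^sub>k :: "real^'n^'n" and S\<^sub>k Y\<^sub>k :: "real^'q^'n"
  assumes "sym_posdef B\<^sub>k"
    and "sym_posdef (transpose S\<^sub>k ** Y\<^sub>k)"
  shows "\<exists>B\<^sub>k\<^sub>1. invertible B\<^sub>k\<^sub>1 \<and> matrix_inv B\<^sub>k\<^sub>1 = block_bfgs_inv B\<^sub>k S\<^sub>k Y\<^sub>k \<and>
    is_arg_min (\<lambda>B. gaussian_rel_entropy B B\<^sub>k)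
      (\<lambda>B. sym_posdef B \<and> matrix_inv B ** Y\<^sub>k = S\<^sub>k) B\<^sub>k\<^sub>1"
proof -
  define H where "H = block_bfgs_inv B\<^sub>k S\<^sub>k Y\<^sub>k"
  define B1 where "B1 = matrix_inv H"
  have M: "invertible (transpose S\<^sub>k ** Y\<^sub>k)"
    using assms(2) by (rule sym_posdef_imp_invertible)
  have H: "sym_posdef H" unfolding H_def using assms by (rule sym_posdef_block_bfgs_inv)
  then have B1: "sym_posdef B1" unfolding B1_def by (rule sym_posdef_matrix_inv)
  have B1H: "B1 ** H = mat 1" "H ** B1 = mat 1"
    unfolding B1_def using invertible_matrix_inv_mul[OF sym_posdef_imp_invertible[OF H]] by auto
  then have invB1: "matrix_inv B1 = H" by (intro matrix_inv_unique_right)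
  have feasible: "matrix_inv B1 ** Y\<^sub>k = S\<^sub>k"
    unfolding invB1 H_def by (rule block_bfgs_inv_secant[OF M])
  have "gaussian_rel_entropy B1 B\<^sub>k \<le> gaussian_rel_entropy B B\<^sub>k"
    if B: "sym_posdef B" and BS: "matrix_inv B ** Y\<^sub>k = S\<^sub>k" for B
  proof -
    have secant: "C ** S\<^sub>k = Y\<^sub>k" if "sym_posdef C" "matrix_inv C ** Y\<^sub>k = S\<^sub>k" for C
      by (metis that invertible_matrix_inv_mul(1) matrix_mul_assoc matrix_mul_lid
          sym_posdef_imp_invertible)
    define D where "D = B - B1"
    have DS: "D ** S\<^sub>k = 0"
      by (simp add: D_def matrix_diff_rdistrib secant[OF B BS] secant[OF B1 feasible])
    have "transpose D = D"
      using B B1 by (simp add: D_def transpose_diff sym_posdef_def)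
    then have "transpose S\<^sub>k ** D = transpose (D ** S\<^sub>k)"
      by (simp add: matrix_transpose_mul)
    also have "\<dots> = 0" by (simp add: DS transpose_def vec_eq_iff)
    finally have "trace (H ** D) = trace (matrix_inv B\<^sub>k ** D)"
      unfolding H_def using trace_block_bfgs_inv_mult[OF _ M DS] assms(2)
      by (simp add: sym_posdef_def)
    \<comment> \<open>The dimension enters as the trace of \<open>H ** B1\<close>, which is the
      identity matrix.\<close>
    then have "trace (matrix_inv B\<^sub>k ** B) - trace (matrix_inv B\<^sub>k ** B1)
        = trace (H ** B) - real CARD('n)"
      by (simp add: D_def matrix_diff_ldistrib trace_sub B1H trace_I)
    moreover have "ln (det B) - ln (det B1) \<le> trace (H ** B) - real CARD('n)"
      using sym_posdef_mult_ln_det_le_trace[OF H B] ln_det_matrix_inv_mult[OF B1 B]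
      by (simp add: invB1)
    \<comment> \<open>In the difference of the two entropies \<open>ln (det B\<^sub>k)\<close> and
      the dimension cancel. What remains is half of the trace difference minus the log-determinant
      difference, and the two preceding facts make it nonnegative.\<close>
    ultimately show ?thesis
      unfolding gaussian_rel_entropy_def
      using ln_det_matrix_inv_mult[OF B assms(1)] ln_det_matrix_inv_mult[OF B1 assms(1)] by simp
  qed
  then have "is_arg_min (\<lambda>B. gaussian_rel_entropy B B\<^sub>k)
      (\<lambda>B. sym_posdef B \<and> matrix_inv B ** Y\<^sub>k = S\<^sub>k) B1"
    unfolding is_arg_min_def using B1 feasible by (auto simp: not_less)
  then show ?thesis
    using sym_posdef_imp_invertible[OF B1] invB1 unfolding H_def by blast
qed

end
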